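(* The tree $T_B(\infty)$ can be represented by the infinite chain defined as follows: for each $i\ge 1$, the $i$-th node of this chain is the partition $(1,\dots,1)$ with $i-1$ ones (so the first node is the empty partition $()$); it is linked to the following node of the chain by an edge of $T_B(\infty)$ labeled with $i$, and it is the root of an $X_{i-1}$ subtree. That is, the node set of $T_B(\infty)$ is the disjoint union, over $i\ge 1$, of the node sets of the $X_{i-1}$ subtrees rooted at the chain nodes, and the edges of $T_B(\infty)$ are exactly the edges of these subtrees together with the edges of the chain.
   Context: A partition is a finite sequence of integers $a=(a_1,\dots,a_k)$ with $a_1\ge\dots\ge a_k>0$ (the empty partition $()$ is allowed); by convention $a_j=0$ for $j>k$. $a^{\downarrow_i}$ denotes the sequence obtained from $a$ by replacing $a_i$ by $a_i+1$. $T_B(\infty)$ is the edge-labeled rooted binary tree with root $()$ in which every node $a$ has a left son $a^{\downarrow_1}$ (edge labeled $1$), and in which a nonempty node $a$ has in addition a right son exactly when, with $p\ge 1$ denoting the number of parts of $a$ equal to $a_1$, one has $a_p-a_{p+1}=1$; the right son is then $a^{\downarrow_{p+1}}$ (edge labeled $p+1$). Its nodes are the partitions generated from the root in this way. For $k\ge 1$, an $X_k$ subtree is a subtree of $T_B(\infty)$ rooted at a node $a=(i,\dots,i,a_{k+1},\dots)$ whose first $k$ parts equal $i$ and with $a_{k+1}\le i-1$, and which is: the whole subtree of $T_B(\infty)$ rooted at $a$ if $a$ has only one son; and otherwise $a$ together with its left subtree (the whole subtree rooted at its left son, and the edge to it). An $X_0$ subtree is a single node. *)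

theory Defs
  imports Main
begin

definition is_partition :: "nat list \<Rightarrow> bool" where
  "is_partition a \<longleftrightarrow> sorted_wrt (\<ge>) a \<and> (\<forall>x\<in>set a. 0 < x)"

text \<open>Parts are numbered from 1; parts beyond the last one are 0.\<close>

definition part :: "nat list \<Rightarrow> nat \<Rightarrow> nat" where
  "part a j = (if 1 \<le> j \<and> j \<le> length a then a ! (j - 1) else 0)"

definition incr :: "nat list \<Rightarrow> nat \<Rightarrow> nat list" where
  "incr a i = map (\<lambda>j. if j = i then part a j + 1 else part a j) [1..<max i (length a) + 1]"

definition plateau :: "nat list \<Rightarrow> nat" where
  "plateau a = count_list a (part a 1)"

definition left_son :: "nat list \<Rightarrow> nat list" where
  "left_son a = incr a 1"

definition has_right_son :: "nat list \<Rightarrow> bool" where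
  "has_right_son a \<longleftrightarrow> a \<noteq> [] \<and> part a (plateau a) - part a (plateau a + 1) = 1"

definition right_son :: "nat list \<Rightarrow> nat list" where
  "right_son a = incr a (plateau a + 1)"

inductive_set TB_nodes :: "nat list set" where
  root: "[] \<in> TB_nodes"
| left: "a \<in> TB_nodes \<Longrightarrow> left_son a \<in> TB_nodes"
| right: "a \<in> TB_nodes \<Longrightarrow> has_right_son a \<Longrightarrow> right_son a \<in> TB_nodes"

text \<open>An edge is a triple (father, label, son).\<close>

type_synonym edge = "nat list \<times> nat \<times> nat list"

definition TB_edges :: "edge set" where
  "TB_edges = {(a, 1, left_son a) | a. a \<in> TB_nodes} \<union>
     {(a, plateau a + 1, right_son a) | a. a \<in> TB_nodes \<and> has_right_son a}"

text \<open>A subtree is given by its set of nodes and its set of edges.\<close>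

type_synonym subtree = "nat list set \<times> edge set"

definition descendants :: "nat list \<Rightarrow> nat list set" where
  "descendants a = {b. (a, b) \<in> {(x, y). \<exists>l. (x, l, y) \<in> TB_edges}\<^sup>*}"

definition whole_subtree :: "nat list \<Rightarrow> subtree" where
  "whole_subtree a = (descendants a, {(x, l, y). (x, l, y) \<in> TB_edges \<and> x \<in> descendants a})"

definition node_with_left_subtree :: "nat list \<Rightarrow> subtree" where
  "node_with_left_subtree a =
     (insert a (fst (whole_subtree (left_son a))),
      insert (a, 1, left_son a) (snd (whole_subtree (left_son a))))"

definition has_only_one_son :: "nat list \<Rightarrow> bool" where
  "has_only_one_son a \<longleftrightarrow> card {(l, b). (a, l, b) \<in> TB_edges} = 1"

definition is_X_subtree :: "nat \<Rightarrow> nat list \<Rightarrow> subtree \<Rightarrow> bool" where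
  "is_X_subtree k a S \<longleftrightarrow> a \<in> TB_nodes \<and>
     (if k = 0 then S = ({a}, {})
      else (\<exists>i\<ge>1. (\<forall>j\<in>{1..k}. part a j = i) \<and> part a (k + 1) \<le> i - 1) \<and>
        S = (if has_only_one_son a then whole_subtree a else node_with_left_subtree a))"

definition chain :: "nat \<Rightarrow> nat list" where
  "chain i = replicate (i - 1) 1"

text \<open>The nodes are partitions, every node other than the root is the son of exactly one node
  (along exactly one edge), and the root is not a son, so the edges do define a tree on the
  partitions themselves.\<close>

lemma part_incr:
  assumes "1 \<le> i" "1 \<le> j"
  shows "part (incr a i) j = (if j = i then part a j + 1 else part a j)"
proof -
  have len: "length (incr a i) = max i (length a)"
    using assms(1) by (simp add: incr_def)
  show ?thesis
  proof (cases "j \<le> max i (length a)")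
    case True
    then have "part (incr a i) j = incr a i ! (j - 1)"
      using assms(2) by (simp add: part_def[of "incr a i"] len)
    also have "j - 1 < length [1..<max i (length a) + 1]"
      using True assms by simp
    then have "incr a i ! (j - 1) =
        (\<lambda>j. if j = i then part a j + 1 else part a j) ([1..<max i (length a) + 1] ! (j - 1))"
      unfolding incr_def by (rule nth_map)
    also have "[1..<max i (length a) + 1] ! (j - 1) = j"
      using True assms(2) by (simp add: nth_upt del: upt_Suc)
    finally show ?thesis .
  next
    case False
    then show ?thesis using assms by (auto simp: part_def len)
  qed
qed

lemma partition_antimono:
  assumes "is_partition a" "1 \<le> j" "j \<le> k"
  shows "part a k \<le> part a j"
proof (cases "j = k \<or> length a < k")
  case False
  then show ?thesis using assms
    by (auto simp: is_partition_def part_def sorted_wrt_iff_nth_less)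
qed (auto simp: part_def)

lemma partition_part_pos: "is_partition a \<Longrightarrow> 1 \<le> j \<Longrightarrow> 0 < part a j \<longleftrightarrow> j \<le> length a"
  by (auto simp: is_partition_def part_def)

lemma partition_eqI:
  assumes "is_partition a" "is_partition b" "\<And>j. 1 \<le> j \<Longrightarrow> part a j = part b j"
  shows "a = b"
proof -
  have *: "j \<le> length a \<longleftrightarrow> j \<le> length b" if "1 \<le> j" for j
    using that assms partition_part_pos by metis
  have len: "length a = length b"
    using *[of "length a"] *[of "length b"] by (cases "length a"; cases "length b") auto
  show ?thesis
  proof (rule nth_equalityI[OF len])
    fix i assume "i < length a"
    then show "a ! i = b ! i"
      using assms(3)[of "Suc i"] len by (simp add: part_def)
  qed
qed

lemma count_list_prefix:
  "sorted_wrt (\<ge>) a \<Longrightarrow> \<forall>y\<in>set a. y \<le> (x::nat) \<Longrightarrow> i < count_list a x \<Longrightarrow> a ! i = x"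
proof (induction a arbitrary: i)
  case (Cons y a)
  show ?case
  proof (cases "y = x")
    case True
    then show ?thesis using Cons by (cases i) auto
  next
    case False
    then have "x \<notin> set (y # a)" using Cons.prems by fastforce
    then show ?thesis using Cons.prems(3) by (simp add: count_list_0_iff)
  qed
qed simp

lemma part_plateau:
  assumes "is_partition a" "1 \<le> j" "j \<le> plateau a"
  shows "part a j = part a 1"
proof -
  have "\<forall>y\<in>set a. y \<le> part a 1"
    using assms(1) by (cases a) (auto simp: is_partition_def part_def)
  moreover have "plateau a \<le> length a"
    by (simp add: plateau_def count_le_length)
  moreover have "j - 1 < count_list a (part a 1)"
    using assms by (simp add: plateau_def)
  ultimately have "a ! (j - 1) = part a 1" "j \<le> length a"
    using count_list_prefix[of a "part a 1" "j - 1"] assms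
    by (simp_all add: is_partition_def)
  then show ?thesis using assms(2) by (simp add: part_def[of a j])
qed

lemma plateau_pos: "a \<noteq> [] \<Longrightarrow> 1 \<le> plateau a"
  by (cases a) (auto simp: plateau_def part_def)

lemma partition_incr:
  assumes "is_partition a" "i = 1 \<or> 1 < i \<and> part a i < part a (i - 1)"
  shows "is_partition (incr a i)"
proof -
  have i: "1 \<le> i" "i \<le> length a + 1"
    using assms(2) by (auto simp: part_def split: if_splits)
  have len: "length (incr a i) = max i (length a)"
    using i by (simp add: incr_def)
  have nth: "incr a i ! j = part (incr a i) (Suc j)" if "j < length (incr a i)" for j
    using that by (simp add: part_def)
  have mono: "part (incr a i) k \<le> part (incr a i) j" if "1 \<le> j" "j < k" for j k
  proof (cases "k = i")
    case True
    have "part a (i - 1) \<le> part a j"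
      using that True by (intro partition_antimono[OF assms(1)]) auto
    then show ?thesis
      using that True assms(2) i by (simp add: part_incr)
  next
    case False
    then show ?thesis
      using that i partition_antimono[OF assms(1), of j k]
      by (auto simp: part_incr)
  qed
  have "0 < part (incr a i) j" if "1 \<le> j" "j \<le> max i (length a)" for j
  proof (cases "j = i")
    case True
    then show ?thesis using i by (simp add: part_incr)
  next
    case False
    then have "j \<le> length a" using that i by auto
    then show ?thesis
      using that i False partition_part_pos[OF assms(1), of j] by (simp add: part_incr)
  qed
  then show ?thesis
    unfolding is_partition_def sorted_wrt_iff_nth_less
    using mono by (auto simp: nth in_set_conv_nth len)
qed

lemma TB_nodes_partition: "a \<in> TB_nodes \<Longrightarrow> is_partition a"
proof (induction rule: TB_nodes.induct)
  case root
  show ?case by (simp add: is_partition_def)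
next
  case (left a)
  then show ?case by (simp add: left_son_def partition_incr)
next
  case (right a)
  then show ?case
    using plateau_pos[of a] by (auto simp: right_son_def has_right_son_def intro!: partition_incr)
qed

lemma TB_edge_props:
  assumes "(a, l, b) \<in> TB_edges"
  shows "a \<in> TB_nodes" "b \<in> TB_nodes" "1 \<le> l" "b = incr a l"
    "\<forall>j\<in>{1..l}. part b j = part b 1" "part b (l + 1) < part b 1"
proof -
  show a: "a \<in> TB_nodes" and "b \<in> TB_nodes" and "1 \<le> l" and b: "b = incr a l"
    using assms TB_nodes.left[of a] TB_nodes.right[of a]
    by (auto simp: TB_edges_def left_son_def right_son_def)
  have a': "is_partition a" using a by (rule TB_nodes_partition)
  consider "l = 1" | "l = plateau a + 1" "has_right_son a"
    using assms by (auto simp: TB_edges_def)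
  then have "(\<forall>j\<in>{1..l}. part b j = part b 1) \<and> part b (l + 1) < part b 1"
  proof cases
    case 1
    then show ?thesis
      using partition_antimono[OF a', of 1 2] b by (auto simp: part_incr numeral_2_eq_2)
  next
    case 2
    have p: "1 \<le> plateau a" using 2 plateau_pos by (auto simp: has_right_son_def)
    have "part a (plateau a) = part a 1" using p part_plateau[OF a'] by blast
    then have q: "part a (plateau a + 1) + 1 = part a 1"
      using 2(2) unfolding has_right_son_def by linarith
    have "part a (plateau a + 2) \<le> part a (plateau a + 1)"
      by (rule partition_antimono[OF a']) auto
    then have "part b (l + 1) < part b 1"
      using p q unfolding b 2(1) by (simp add: part_incr)
    moreover have "part b j = part b 1" if "j \<in> {1..l}" for j
    proof (cases "j = l")
      case True
      then show ?thesis using p q unfolding b 2(1) by (simp add: part_incr)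
    next
      case False
      then have "part a j = part a 1"
        using that 2(1) part_plateau[OF a', of j] by simp
      then show ?thesis using False that p unfolding b 2(1) by (simp add: part_incr)
    qed
    ultimately show ?thesis by blast
  qed
  then show "\<forall>j\<in>{1..l}. part b j = part b 1" "part b (l + 1) < part b 1" by blast+
qed

lemma TB_father_exists: "b \<in> TB_nodes \<Longrightarrow> b \<noteq> [] \<Longrightarrow> \<exists>a l. (a, l, b) \<in> TB_edges"
proof (erule TB_nodes.cases)
  fix a assume "b = left_son a" "a \<in> TB_nodes"
  then have "(a, 1, b) \<in> TB_edges" by (simp add: TB_edges_def)
  then show ?thesis by blast
next
  fix a assume "b = right_son a" "a \<in> TB_nodes" "has_right_son a"
  then have "(a, plateau a + 1, b) \<in> TB_edges" by (simp add: TB_edges_def)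
  then show ?thesis by blast
qed simp

lemma TB_father_unique:
  assumes "(a, l, b) \<in> TB_edges" "(a', l', b) \<in> TB_edges"
  shows "a = a' \<and> l = l'"
proof -
  note p = TB_edge_props[OF assms(1)] and p' = TB_edge_props[OF assms(2)]
  have "\<not> l < l'" using p(6) bspec[OF p'(5), of "l + 1"] by auto
  moreover have "\<not> l' < l" using p'(6) bspec[OF p(5), of "l' + 1"] by auto
  ultimately have l: "l = l'" by simp
  have "a = a'"
  proof (rule partition_eqI)
    fix j :: nat assume "1 \<le> j"
    then show "part a j = part a' j"
      using part_incr[OF p(3), of j a] part_incr[OF p(3), of j a'] p(4) p'(4) l
      by (metis add_right_cancel)
  qed (use p(1) p'(1) TB_nodes_partition in auto)
  with l show ?thesis by simp
qed

lemma TB_root_no_father: "(a, l, []) \<notin> TB_edges"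
proof
  assume "(a, l, []) \<in> TB_edges"
  from TB_edge_props(6)[OF this] show False by (simp add: part_def)
qed

end

theory Submission
  imports Defs
begin

text \<open>For \<open>i \<ge> 2\<close> the chain node \<open>(1,\<dots>,1)\<close> has exactly two sons: its left son and the next chain
  node. The descendants of the left son all have a first part of size at least 2, so they avoid the
  chain; and two such families of descendants could only meet if the left son of one chain node were
  a proper descendant of the left son of another, whence its father, a chain node, would have a
  first part of size at least 2.\<close>

section \<open>Ancestors and descendants in the tree\<close>

abbreviation son_rel :: "nat list rel" where
  "son_rel \<equiv> {(x, y). \<exists>l. (x, l, y) \<in> TB_edges}"

lemma mem_descendants: "b \<in> descendants a \<longleftrightarrow> (a, b) \<in> son_rel\<^sup>*"
  by (simp add: descendants_def)

lemma descendants_refl: "a \<in> descendants a"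
  by (simp add: descendants_def)

lemma descendants_son:
  assumes "x \<in> descendants a" "(x, l, y) \<in> TB_edges"
  shows "y \<in> descendants a"
proof -
  have "(x, y) \<in> son_rel" using assms(2) by blast
  with assms(1) show ?thesis
    unfolding mem_descendants by (rule rtrancl.rtrancl_into_rtrancl)
qed

text \<open>A nontrivial path from \<open>a\<close> to \<open>y\<close> ends with an edge into
  \<open>y\<close>, and by uniqueness of fathers that edge starts at \<open>x\<close>.\<close>

lemma descendants_father:
  assumes "y \<in> descendants a" "y \<noteq> a" "(x, l, y) \<in> TB_edges"
  shows "x \<in> descendants a"
  using assms(1) unfolding mem_descendants
proof (cases rule: rtrancl.cases)
  case rtrancl_refl
  with assms(2) show "(a, x) \<in> son_rel\<^sup>*" by simp
next
  case (rtrancl_into_rtrancl z)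
  then show "(a, x) \<in> son_rel\<^sup>*" using TB_father_unique assms(3) by blast
qed

text \<open>Going upwards from \<open>x\<close> is deterministic, since fathers are unique. Hence
  all ancestors of \<open>x\<close> lie on a single upward path, and any two of them are
  comparable.\<close>

lemma descendants_comparable:
  assumes "x \<in> descendants a" "x \<in> descendants b"
  shows "a \<in> descendants b \<or> b \<in> descendants a"
proof -
  have "single_valued (son_rel\<inverse>)"
    using TB_father_unique by (auto simp: single_valued_def)
  moreover have "(x, a) \<in> (son_rel\<inverse>)\<^sup>*" "(x, b) \<in> (son_rel\<inverse>)\<^sup>*"
    using assms by (simp_all only: mem_descendants rtrancl_converse converse_iff)
  ultimately have "(a, b) \<in> (son_rel\<inverse>)\<^sup>* \<or> (b, a) \<in> (son_rel\<inverse>)\<^sup>*"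
    by (rule single_valued_confluent)
  then show ?thesis by (simp only: mem_descendants rtrancl_converse converse_iff)
qed

lemma descendants_TB_nodes:
  assumes "a \<in> TB_nodes"
  shows "descendants a \<subseteq> TB_nodes"
proof
  fix b assume "b \<in> descendants a"
  then show "b \<in> TB_nodes"
    unfolding mem_descendants using assms by (induction) (auto dest: TB_edge_props(2))
qed

text \<open>Every edge increments one part and keeps the others, so no part shrinks along a
  path.\<close>

lemma descendants_first_part_mono:
  assumes "b \<in> descendants a"
  shows "part a 1 \<le> part b 1"
  using assms unfolding mem_descendants
proof induction
  case (step y z)
  then obtain l where "(y, l, z) \<in> TB_edges" by blast
  from TB_edge_props(3,4)[OF this] have "part y 1 \<le> part z 1"
    by (simp add: part_incr)
  with step.IH show ?case by (rule le_trans)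
qed simp

section \<open>The chain nodes and their sons\<close>

lemma part_chain: "part (chain i) j = (if 1 \<le> j \<and> j < i then 1 else 0)"
  by (auto simp: chain_def part_def)

lemma length_chain: "length (chain i) = i - 1"
  by (simp add: chain_def)

lemma is_partition_chain: "is_partition (chain i)"
  by (simp add: chain_def is_partition_def sorted_wrt_iff_nth_less)

lemma chain_eq_Nil: "chain i = [] \<longleftrightarrow> i \<le> 1"
  by (auto simp: chain_def)

text \<open>Entry \<open>i\<close> is the first zero past the \<open>i - 1\<close> ones, so
  incrementing it appends one more 1.\<close>

lemma incr_chain:
  assumes "1 \<le> i"
  shows "incr (chain i) i = chain (i + 1)"
proof (rule partition_eqI)
  show "is_partition (incr (chain i) i)"
    using assms by (intro partition_incr is_partition_chain) (auto simp: part_chain)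
qed (use assms in \<open>auto simp: is_partition_chain part_incr part_chain\<close>)

lemma plateau_chain: "2 \<le> i \<Longrightarrow> plateau (chain i) = i - 1"
proof -
  assume "2 \<le> i"
  moreover have "count_list (replicate n (1::nat)) 1 = n" for n by (induction n) auto
  ultimately show ?thesis by (simp add: plateau_def part_chain) (simp add: chain_def)
qed

text \<open>For \<open>2 \<le> i\<close> the last 1 is followed by the default value 0, a drop of
  exactly 1. Otherwise the node is the root, which is empty and has no right son.\<close>

lemma has_right_son_chain: "has_right_son (chain i) \<longleftrightarrow> 2 \<le> i"
  by (cases "2 \<le> i") (auto simp: has_right_son_def plateau_chain part_chain chain_eq_Nil)

text \<open>The root is exceptional: the chain leaves it through its left son, whereas every later
  chain edge leads to a right son.\<close>

lemma left_son_chain_1: "left_son (chain 1) = chain 2"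
  using incr_chain[of 1] by (simp add: left_son_def numeral_2_eq_2)

lemma right_son_chain: "2 \<le> i \<Longrightarrow> right_son (chain i) = chain (i + 1)"
  by (simp add: right_son_def plateau_chain incr_chain)

lemma chain_in_TB_nodes: "1 \<le> i \<Longrightarrow> chain i \<in> TB_nodes"
proof (induction i rule: nat_induct_at_least)
  case base
  show ?case using TB_nodes.root by (simp add: chain_def)
next
  case (Suc i)
  then show ?case
    using TB_nodes.left[of "chain i"] TB_nodes.right[of "chain i"] left_son_chain_1
    by (cases "i = 1") (auto simp: has_right_son_chain right_son_chain numeral_2_eq_2)
qed

text \<open>At the root the edge labeled 1 is itself the chain edge. The guard
  \<open>2 \<le> i\<close> in the second alternative keeps it from being counted again as an edge
  into a left subtree.\<close>

lemma chain_edge_iff: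
  assumes "1 \<le> i"
  shows "(chain i, l, b) \<in> TB_edges \<longleftrightarrow>
    l = i \<and> b = chain (i + 1) \<or> 2 \<le> i \<and> l = 1 \<and> b = left_son (chain i)"
proof (cases "i = 1")
  case True
  then show ?thesis
    using chain_in_TB_nodes[OF assms] left_son_chain_1
    by (auto simp: TB_edges_def has_right_son_chain numeral_2_eq_2)
next
  case False
  with assms have "2 \<le> i" by simp
  then show ?thesis
    using chain_in_TB_nodes[OF assms]
    by (auto simp: TB_edges_def has_right_son_chain right_son_chain plateau_chain)
qed

text \<open>The labels \<open>i\<close> and 1 differ, so the two edges are distinct. This selects
  the \<open>node_with_left_subtree\<close> case of \<open>is_X_subtree\<close>.\<close>

lemma not_has_only_one_son_chain:
  assumes "2 \<le> i"
  shows "\<not> has_only_one_son (chain i)"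
proof -
  have "{(l, b). (chain i, l, b) \<in> TB_edges} = {(i, chain (i + 1)), (1, left_son (chain i))}"
    using assms by (auto simp: chain_edge_iff)
  then show ?thesis using assms by (simp add: has_only_one_son_def)
qed

section \<open>Left subtrees hanging from the chain, and the resulting X subtrees\<close>

lemma descendants_left_son_chain_first_part:
  assumes "2 \<le> i" "b \<in> descendants (left_son (chain i))"
  shows "2 \<le> part b 1"
  using descendants_first_part_mono[OF assms(2)] assms(1)
  by (simp add: left_son_def part_incr part_chain)

lemma chain_notin_descendants_left_son_chain:
  "2 \<le> i \<Longrightarrow> chain j \<notin> descendants (left_son (chain i))"
  using descendants_left_son_chain_first_part[of i "chain j"]
  by (auto simp: part_chain split: if_splits)

lemma left_son_chain_in_descendants:
  assumes "2 \<le> i" "2 \<le> j" "left_son (chain i) \<in> descendants (left_son (chain j))"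
  shows "i = j"
proof -
  have e: "(chain i, 1, left_son (chain i)) \<in> TB_edges" "(chain j, 1, left_son (chain j)) \<in> TB_edges"
    using assms by (simp_all add: chain_edge_iff)
  \<comment> \<open>If they differed, the father \<open>chain i\<close> of the first would also
    descend from the second, where no chain node lies.\<close>
  have "left_son (chain i) = left_son (chain j)"
    using descendants_father[OF assms(3) _ e(1)] chain_notin_descendants_left_son_chain[OF assms(2)]
    by blast
  then have "chain i = chain j" using e TB_father_unique by metis
  \<comment> \<open>Length determines the index only from 1 on, because
    \<open>chain 0 = chain 1\<close>.\<close>
  then have "length (chain i) = length (chain j)" by simp
  then show ?thesis using assms(1,2) by (simp add: length_chain)
qed

lemma disjoint_descendants_left_son_chain:
  assumes "2 \<le> i" "2 \<le> j" "i \<noteq> j"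
  shows "descendants (left_son (chain i)) \<inter> descendants (left_son (chain j)) = {}"
  using descendants_comparable left_son_chain_in_descendants assms by blast

text \<open>The root stands alone because its left subtree already contains the rest of the chain.
  Index 0 is a dummy value.\<close>

definition chain_subtree :: "nat \<Rightarrow> subtree" where
  "chain_subtree i = (if i \<le> 1 then ({chain i}, {}) else node_with_left_subtree (chain i))"

lemma fst_chain_subtree:
  "fst (chain_subtree i) =
    insert (chain i) (if 2 \<le> i then descendants (left_son (chain i)) else {})"
  by (simp add: chain_subtree_def node_with_left_subtree_def whole_subtree_def)

lemma snd_chain_subtree:
  "snd (chain_subtree i) =
    (if 2 \<le> i then insert (chain i, 1, left_son (chain i))
        {(x, l, y). (x, l, y) \<in> TB_edges \<and> x \<in> descendants (left_son (chain i))} else {})"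
  by (simp add: chain_subtree_def node_with_left_subtree_def whole_subtree_def)

lemma is_X_subtree_chain_subtree:
  assumes "1 \<le> i"
  shows "is_X_subtree (i - 1) (chain i) (chain_subtree i)"
proof (cases "i = 1")
  case True
  then show ?thesis
    using chain_in_TB_nodes[OF assms] by (simp add: is_X_subtree_def chain_subtree_def)
next
  case False
  with assms have "2 \<le> i" by simp
  \<comment> \<open>The common value is 1: all \<open>i - 1\<close> parts equal 1, and the next
    entry is 0.\<close>
  moreover from this have "\<exists>v\<ge>1. (\<forall>j\<in>{1..i - 1}. part (chain i) j = v) \<and> part (chain i) i \<le> v - 1"
    by (intro exI[of _ 1]) (auto simp: part_chain)
  ultimately show ?thesis
    using chain_in_TB_nodes[OF assms] not_has_only_one_son_chain[of i]
    by (simp add: is_X_subtree_def chain_subtree_def)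
qed

text \<open>The only way out of a subtree is the chain edge at its root, since descendants of the
  left son are closed under taking sons. Both the covering of the nodes and that of the edges rest
  on this.\<close>

lemma TB_edge_from_chain_subtree:
  assumes "1 \<le> i" "x \<in> fst (chain_subtree i)" "(x, l, y) \<in> TB_edges"
  shows "(x, l, y) \<in> snd (chain_subtree i) \<and> y \<in> fst (chain_subtree i) \<or>
    (x, l, y) = (chain i, i, chain (i + 1))"
proof (cases "x = chain i")
  case True
  then show ?thesis
    using assms(3) chain_edge_iff[OF assms(1)] descendants_refl
    by (auto simp: fst_chain_subtree snd_chain_subtree)
next
  case False
  then show ?thesis
    using assms(2,3) descendants_son
    by (auto simp: fst_chain_subtree snd_chain_subtree split: if_splits)
qed

section \<open>The decomposition of nodes and edges\<close>

lemma TB_nodes_eq: "TB_nodes = (\<Union>i\<in>{1..}. fst (chain_subtree i))"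
proof
  \<comment> \<open>Closure of the union under sons: an edge leaving subtree \<open>i\<close> ends
    at the root of subtree \<open>i + 1\<close>.\<close>
  have son: "y \<in> (\<Union>i\<in>{1..}. fst (chain_subtree i))"
    if "x \<in> (\<Union>i\<in>{1..}. fst (chain_subtree i))" "(x, l, y) \<in> TB_edges" for x l y
  proof -
    from that(1) obtain i where i: "1 \<le> i" "x \<in> fst (chain_subtree i)" by auto
    have "chain (i + 1) \<in> fst (chain_subtree (i + 1))" by (simp add: fst_chain_subtree)
    then have "y \<in> fst (chain_subtree i) \<or> y \<in> fst (chain_subtree (i + 1))"
      using TB_edge_from_chain_subtree[OF i that(2)] by auto
    then show ?thesis using i(1) by force
  qed
  show "TB_nodes \<subseteq> (\<Union>i\<in>{1..}. fst (chain_subtree i))"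
  proof
    fix a assume "a \<in> TB_nodes"
    then show "a \<in> (\<Union>i\<in>{1..}. fst (chain_subtree i))"
    proof induction
      case root
      have "[] \<in> fst (chain_subtree 1)" by (simp add: fst_chain_subtree chain_def)
      then show ?case by blast
    next
      case (left a)
      then have "(a, 1, left_son a) \<in> TB_edges" by (simp add: TB_edges_def)
      with left.IH show ?case by (rule son)
    next
      case (right a)
      then have "(a, plateau a + 1, right_son a) \<in> TB_edges" by (simp add: TB_edges_def)
      with right.IH show ?case by (rule son)
    qed
  qed
  show "(\<Union>i\<in>{1..}. fst (chain_subtree i)) \<subseteq> TB_nodes"
  proof (rule UN_least)
    fix i :: nat assume "i \<in> {1..}"
    then have "chain i \<in> TB_nodes" by (simp add: chain_in_TB_nodes)
    then show "fst (chain_subtree i) \<subseteq> TB_nodes"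
      using descendants_TB_nodes[OF TB_nodes.left] by (simp add: fst_chain_subtree)
  qed
qed

lemma disjoint_chain_subtrees:
  assumes "1 \<le> i" "1 \<le> j" "i \<noteq> j"
  shows "fst (chain_subtree i) \<inter> fst (chain_subtree j) = {}"
proof -
  have "length (chain i) \<noteq> length (chain j)" using assms by (auto simp: length_chain)
  then have "chain i \<noteq> chain j" by auto
  then show ?thesis
    using disjoint_descendants_left_son_chain[of i j] assms(3)
    by (auto simp: fst_chain_subtree chain_notin_descendants_left_son_chain split: if_splits)
qed

lemma TB_edges_eq:
  "TB_edges = (\<Union>i\<in>{1..}. snd (chain_subtree i)) \<union> {(chain i, i, chain (i + 1)) | i. i \<ge> 1}"
proof
  show "TB_edges \<subseteq> (\<Union>i\<in>{1..}. snd (chain_subtree i)) \<union> {(chain i, i, chain (i + 1)) | i. i \<ge> 1}"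
  proof
    fix e assume e: "e \<in> TB_edges"
    obtain x l y where xly: "e = (x, l, y)" by (cases e)
    \<comment> \<open>An edge is assigned to the subtree that contains its father.\<close>
    with e have "x \<in> TB_nodes" using TB_edge_props(1) by simp
    then obtain i where i: "1 \<le> i" "x \<in> fst (chain_subtree i)" by (auto simp: TB_nodes_eq)
    have "e \<in> snd (chain_subtree i) \<or> e = (chain i, i, chain (i + 1))"
      using TB_edge_from_chain_subtree[OF i] e xly by blast
    then show "e \<in> (\<Union>i\<in>{1..}. snd (chain_subtree i)) \<union> {(chain i, i, chain (i + 1)) | i. i \<ge> 1}"
      using i(1) by auto
  qed
  show "(\<Union>i\<in>{1..}. snd (chain_subtree i)) \<union> {(chain i, i, chain (i + 1)) | i. i \<ge> 1} \<subseteq> TB_edges"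
    by (auto simp: snd_chain_subtree chain_edge_iff split: if_splits)
qed

theorem theorem4:
  shows "\<exists>X :: nat \<Rightarrow> subtree.
    chain 1 = [] \<and>
    (\<forall>i\<ge>1. is_X_subtree (i - 1) (chain i) (X i)) \<and>
    (\<forall>i\<ge>1. (chain i, i, chain (i + 1)) \<in> TB_edges) \<and>
    TB_nodes = (\<Union>i\<in>{1..}. fst (X i)) \<and>
    (\<forall>i\<ge>1. \<forall>j\<ge>1. i \<noteq> j \<longrightarrow> fst (X i) \<inter> fst (X j) = {}) \<and>
    TB_edges = (\<Union>i\<in>{1..}. snd (X i)) \<union> {(chain i, i, chain (i + 1)) | i. i \<ge> 1}"
proof (intro exI[of _ chain_subtree] conjI)
  show "chain 1 = []" by (simp add: chain_eq_Nil)
  show "\<forall>i\<ge>1. is_X_subtree (i - 1) (chain i) (chain_subtree i)"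
    using is_X_subtree_chain_subtree by blast
  show "\<forall>i\<ge>1. (chain i, i, chain (i + 1)) \<in> TB_edges"
    by (simp add: chain_edge_iff)
  show "\<forall>i\<ge>1. \<forall>j\<ge>1. i \<noteq> j \<longrightarrow> fst (chain_subtree i) \<inter> fst (chain_subtree j) = {}"
    using disjoint_chain_subtrees by blast
qed (fact TB_nodes_eq TB_edges_eq)+

end
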